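(* Let $X$ be a finite nonempty set of cardinality $n$ and let $N=\binom{n}{2}$. The number of idempotent elements in $\mathcal{M}(X)$ is exactly $$\sum_{d=1}^n\binom{n}{d}d^{\,n-d}\sum_{a=0}^{N}\binom{N}{a}(2a+d)^{N-a}.$$
   Context: $\mathcal{M}(X)=X^{X\times X}$ is the set of all binary operations on $X$, a monoid under $\triangleright$ defined by $a(\circ\triangleright\ast)b=(a\circ b)\ast(b\circ a)$ for all $a,b\in X$. An element $\ast\in\mathcal{M}(X)$ is idempotent if $\ast\triangleright\ast=\ast$. *)

theory Defs
  imports "HOL-Algebra.Group"
begin

(* A binary operation on the set X is an extensional function X \<times> X \<rightarrow> X, so that
   distinct elements of the carrier are distinct operations on X. *)
definition binops :: "'a set \<Rightarrow> ('a \<times> 'a \<Rightarrow> 'a) monoid" where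
  "binops X =
     \<lparr>carrier = X \<times> X \<rightarrow>\<^sub>E X,
      mult = (\<lambda>f g. \<lambda>(a, b) \<in> X \<times> X. g (f (a, b), f (b, a))),
      one = (\<lambda>(a, b) \<in> X \<times> X. a)\<rparr>"

lemma monoid_binops: "monoid (binops X)"
proof (rule monoidI)
  fix f g h
  assume f: "f \<in> carrier (binops X)" and g: "g \<in> carrier (binops X)"
  have fX: "f (a, b) \<in> X" if "a \<in> X" "b \<in> X" for a b
    using f that by (auto simp: binops_def)
  then show "f \<otimes>\<^bsub>binops X\<^esub> g \<in> carrier (binops X)"
    using g by (auto simp: binops_def)
  show "f \<otimes>\<^bsub>binops X\<^esub> g \<otimes>\<^bsub>binops X\<^esub> h = f \<otimes>\<^bsub>binops X\<^esub> (g \<otimes>\<^bsub>binops X\<^esub> h)"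
    using fX by (auto simp: binops_def fun_eq_iff)
next
  show "\<one>\<^bsub>binops X\<^esub> \<in> carrier (binops X)"
    by (auto simp: binops_def)
next
  fix f
  assume "f \<in> carrier (binops X)"
  then have "restrict f (X \<times> X) = f"
    by (simp add: binops_def PiE_restrict)
  then show "\<one>\<^bsub>binops X\<^esub> \<otimes>\<^bsub>binops X\<^esub> f = f" "f \<otimes>\<^bsub>binops X\<^esub> \<one>\<^bsub>binops X\<^esub> = f"
    using \<open>f \<in> carrier (binops X)\<close>
    by (auto simp: binops_def fun_eq_iff restrict_def PiE_iff extensional_def)
qed

definition idempotents :: "('m, 'more) monoid_scheme \<Rightarrow> 'm set" where
  "idempotents G = {x \<in> carrier G. x \<otimes>\<^bsub>G\<^esub> x = x}"

end

theory Submission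
  imports Defs
begin

text \<open>
  An operation \<open>f\<close> is idempotent iff the map \<open>F (a, b) = (f (a, b), f (b, a))\<close> on
  \<open>X \<times> X\<close>, which commutes with the swap, is an idempotent map. Such a map is determined by its
  swap-invariant set of fixed points, say \<open>d\<close> diagonal points and \<open>a\<close> of the \<open>N\<close>
  off-diagonal orbits, and by the images of representatives of the other orbits: a diagonal point
  must go to one of the \<open>d\<close> fixed diagonal points, an off-diagonal representative may go to any
  of the \<open>2 a + d\<close> fixed points.
\<close>

text \<open>The map \<open>F\<close> of the overview. On \<open>X \<times> X\<close> it turns the
  product of \<open>binops X\<close> into composition of maps, in reversed order.\<close>

definition swap_pair :: "('a \<times> 'a \<Rightarrow> 'a) \<Rightarrow> 'a \<times> 'a \<Rightarrow> 'a \<times> 'a" where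
  "swap_pair f p = (f p, f (prod.swap p))"

text \<open>If \<open>R\<close> holds one representative of each off-diagonal orbit, then every
  swap-invariant subset of \<open>X \<times> X\<close> arises from exactly one pair of
  \<open>D \<subseteq> X\<close> and \<open>A \<subseteq> R\<close>.\<close>

definition sym_points :: "'a set \<Rightarrow> ('a \<times> 'a) set \<Rightarrow> ('a \<times> 'a) set" where
  "sym_points D A = Id_on D \<union> A \<union> A\<inverse>"

definition retractions :: "'a set \<Rightarrow> ('a \<times> 'a) set \<Rightarrow> ('a \<times> 'a \<Rightarrow> 'a) set" where
  "retractions X P = {f \<in> X \<times> X \<rightarrow>\<^sub>E X.
     (\<forall>p \<in> P. swap_pair f p = p) \<and> (\<forall>p \<in> X \<times> X. swap_pair f p \<in> P)}"

text \<open>The first component of the right-hand equation at \<open>(a, b)\<close> is idempotency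
  at \<open>(a, b)\<close>; the second is idempotency at \<open>(b, a)\<close>, so quantifying over
  all pairs adds nothing.\<close>

lemma idempotents_binops_iff:
  "f \<in> idempotents (binops X) \<longleftrightarrow>
     f \<in> X \<times> X \<rightarrow>\<^sub>E X \<and> (\<forall>p \<in> X \<times> X. swap_pair f (swap_pair f p) = swap_pair f p)"
proof -
  have "f \<otimes>\<^bsub>binops X\<^esub> f = f \<longleftrightarrow> (\<forall>a\<in>X. \<forall>b\<in>X. f (f (a, b), f (b, a)) = f (a, b))"
    if "f \<in> X \<times> X \<rightarrow>\<^sub>E X"
    using that by (auto simp: binops_def fun_eq_iff restrict_def PiE_iff extensional_def)
  then show ?thesis
    by (auto simp: idempotents_def swap_pair_def binops_def)
qed

text \<open>A fixed point is its own image, hence lies in \<open>P\<close>. Thus \<open>f\<close>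
  determines \<open>P\<close>, and the classes for different \<open>P\<close> are disjoint.\<close>

lemma retractions_fixed_points:
  assumes "f \<in> retractions X P" "P \<subseteq> X \<times> X"
  shows "{p \<in> X \<times> X. swap_pair f p = p} = P"
  using assms by (force simp: retractions_def)

lemma retractions_idempotents:
  assumes "f \<in> retractions X P"
  shows "f \<in> idempotents (binops X)"
  using assms by (auto simp: retractions_def idempotents_binops_iff)

lemma idempotents_retractions:
  assumes "f \<in> idempotents (binops X)"
  shows "f \<in> retractions X {p \<in> X \<times> X. swap_pair f p = p}"
  using assms by (auto simp: retractions_def idempotents_binops_iff) (auto simp: swap_pair_def PiE_iff)

lemma sym_points_subset:
  assumes "D \<subseteq> X" "A \<subseteq> X \<times> X"
  shows "sym_points D A \<subseteq> X \<times> X"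
  using assms by (auto simp: sym_points_def)

text \<open>The diagonal returns \<open>D\<close>. Intersecting with \<open>R\<close> returns
  \<open>A\<close>, since an asymmetric \<open>R\<close> misses the diagonal and its own
  converse.\<close>

lemma sym_points_inject:
  assumes "asym R" "A \<subseteq> R" "A' \<subseteq> R" "sym_points D A = sym_points D' A'"
  shows "D = D' \<and> A = A'"
proof -
  have D: "D = {x. (x, x) \<in> sym_points D A}" and A: "A = R \<inter> sym_points D A"
    if "A \<subseteq> R" for D A
    using that assms(1) by (auto simp: sym_points_def dest: asymD)
  show ?thesis
    using D A assms(2-4) by metis
qed

lemma card_sym_points:
  assumes "asym R" "A \<subseteq> R" "finite A" "finite D"
  shows "card (sym_points D A) = 2 * card A + card D"
proof -
  have "card (Id_on D) = card D"
    by (simp add: Id_on_def card_UN_disjoint assms)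
  moreover have "Id_on D \<inter> A = {}" "(Id_on D \<union> A) \<inter> A\<inverse> = {}"
    using assms(1,2) by (auto dest: asymD)
  moreover have "finite (Id_on D)"
    by (simp add: Id_on_def assms)
  ultimately show ?thesis
    using assms by (simp add: sym_points_def card_Un_disjoint)
qed

lemma Times_eq_sym_points:
  assumes "total_on X R" "R \<subseteq> X \<times> X"
  shows "X \<times> X = sym_points X R"
  using assms by (auto simp: sym_points_def total_on_def)

text \<open>Counting the square as the diagonal, \<open>R\<close> and the converse of
  \<open>R\<close> gives n^2 = 2 |R| + n for n = |X|.\<close>

lemma card_total_asym:
  assumes "finite X" "total_on X R" "R \<subseteq> X \<times> X" "asym R"
  shows "card R = card X choose 2"
proof -
  have "finite R"
    using assms finite_subset by blast
  then have "card X * card X = 2 * card R + card X"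
    using card_sym_points[OF assms(4) order_refl, of X] assms(1) Times_eq_sym_points[OF assms(2,3)]
    by (metis card_cartesian_product)
  then show ?thesis
    by (simp add: choose_two diff_mult_distrib2)
qed

text \<open>Supplies the orbit representatives: a strict linear order, pulled back along an
  injection into the naturals.\<close>

lemma ex_total_asym:
  assumes "finite X"
  obtains R where "total_on X R" "R \<subseteq> X \<times> X" "asym R"
proof -
  obtain h :: "'a \<Rightarrow> nat" where h: "inj_on h X"
    using finite_imp_inj_to_nat_seg[OF assms] by blast
  show thesis
  proof
    let ?R = "{(x, y) \<in> X \<times> X. h x < h y}"
    show "total_on X ?R"
      using h by (auto simp: total_on_def inj_on_def) (meson nat_neq_iff)
    show "?R \<subseteq> X \<times> X" "asym ?R"
      by (auto intro: asymI)
  qed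
qed

text \<open>Both powers count functions: \<open>U\<close> chooses the images of the non-fixed
  diagonal points, \<open>V\<close> those of the non-fixed representatives. The choices are free and
  independent, and \<open>enc\<close> and \<open>dec\<close> are mutually inverse.\<close>

lemma card_retractions:
  assumes "finite X" "total_on X R" "R \<subseteq> X \<times> X" "asym R" "D \<subseteq> X" "A \<subseteq> R"
  shows "card (retractions X (sym_points D A)) =
    card D ^ (card X - card D) * (2 * card A + card D) ^ (card R - card A)"
proof -
  let ?P = "sym_points D A"
  define U where "U = (X - D \<rightarrow>\<^sub>E D)"
  define V where "V = (R - A \<rightarrow>\<^sub>E ?P)"
  \<comment> \<open>On the diagonal both components of \<open>swap_pair f\<close> agree, so one
    value in \<open>D\<close> suffices; off the diagonal the whole pair is recorded.\<close>
  define enc where "enc = (\<lambda>f. (\<lambda>x\<in>X - D. f (x, x), \<lambda>p\<in>R - A. swap_pair f p))"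
  \<comment> \<open>The last case is forced: the image of \<open>(x, y)\<close> is the swap of the
    image \<open>v (y, x)\<close> of its representative, and its first component is
    \<open>snd (v (y, x))\<close>.\<close>
  define dec where "dec = (\<lambda>(u, v). \<lambda>(x, y)\<in>X \<times> X.
     if (x, y) \<in> ?P then x else if x = y then u x
     else if (x, y) \<in> R then fst (v (x, y)) else snd (v (y, x)) :: 'a)"
  have fin: "finite R" "finite D" "finite A"
    using assms finite_subset by (blast, blast, metis finite_SigmaI finite_subset)
  have PX: "?P \<subseteq> X \<times> X"
    using assms by (intro sym_points_subset) auto
  have Psym: "(y, x) \<in> ?P \<longleftrightarrow> (x, y) \<in> ?P" for x y
    by (auto simp: sym_points_def)
  have diag: "(x, x) \<in> ?P \<longleftrightarrow> x \<in> D" for x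
    using assms(4,6) by (auto simp: sym_points_def dest: asymD)
  have PR: "p \<in> ?P \<longleftrightarrow> p \<in> A" if "p \<in> R" for p
    using that assms(4,6) by (auto simp: sym_points_def dest: asymD)
  have Rcases: "(x, y) \<in> R \<and> (y, x) \<notin> R \<or> (y, x) \<in> R \<and> (x, y) \<notin> R"
    if "x \<in> X" "y \<in> X" "x \<noteq> y" for x y
    using that assms(2,4) by (auto simp: total_on_def dest: asymD)
  have Rirr: "(x, x) \<notin> R" for x
    using assms(4) by (auto dest: asymD)
  have swap_dec: "swap_pair (dec (u, v)) (x, y) =
     (if (x, y) \<in> ?P then (x, y) else if x = y then (u x, u x)
      else if (x, y) \<in> R then v (x, y) else prod.swap (v (y, x)))"
    if "x \<in> X" "y \<in> X" for u v x y
    using that Rcases[of x y] Psym[of x y] by (auto simp: swap_pair_def dec_def prod_eq_iff)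
  have dec_in: "swap_pair (dec (u, v)) (x, y) \<in> ?P"
    if "u \<in> U" "v \<in> V" "x \<in> X" "y \<in> X" for u v x y
  proof -
    have "(u x, u x) \<in> ?P" if "x = y" "(x, y) \<notin> ?P"
      using that \<open>u \<in> U\<close> \<open>x \<in> X\<close> by (auto simp: diag U_def)
    moreover have "v p \<in> ?P" if "p \<in> R" "p \<notin> ?P" for p
      using that \<open>v \<in> V\<close> by (auto simp: PR V_def)
    moreover have "prod.swap (v (y, x)) \<in> ?P" if "(y, x) \<in> R" "(x, y) \<notin> ?P"
      using calculation(2)[of "(y, x)"] that Psym by (cases "v (y, x)") auto
    ultimately show ?thesis
      using Rcases that by (auto simp: swap_dec)
  qed
  have dec_retr: "dec w \<in> retractions X ?P" if UV: "w \<in> U \<times> V" for w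
  proof -
    obtain u v where w: "w = (u, v)" "u \<in> U" "v \<in> V"
      using UV by auto
    have "dec w (x, y) \<in> X" if "x \<in> X" "y \<in> X" for x y
      using dec_in[OF w(2,3) that] PX w(1) by (auto simp: swap_pair_def)
    then have "dec w \<in> X \<times> X \<rightarrow>\<^sub>E X"
      by (auto simp: w dec_def PiE_iff)
    then show ?thesis
      using dec_in[OF w(2,3)] swap_dec PX by (auto simp: retractions_def w(1))
  qed
  have enc_dec: "enc (dec w) = w" if UV: "w \<in> U \<times> V" for w
  proof -
    obtain u v where w: "w = (u, v)" "u \<in> U" "v \<in> V"
      using UV by auto
    have "(\<lambda>x\<in>X - D. dec w (x, x)) = u"
      using w(2) by (auto simp: w(1) dec_def U_def diag PiE_iff extensional_def fun_eq_iff)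
    moreover have "(\<lambda>p\<in>R - A. swap_pair (dec w) p) = v"
    proof
      fix p :: "'a \<times> 'a"
      obtain x y where p: "p = (x, y)"
        by fastforce
      show "(\<lambda>p\<in>R - A. swap_pair (dec w) p) p = v p"
        \<comment> \<open>A point of \<open>R - A\<close> is off the diagonal and outside
          \<open>?P\<close>, so \<open>swap_dec\<close> takes its third case and returns
          \<open>v p\<close>.\<close>
        using w(3) assms(3) PR[of p] Rirr[of x] swap_dec[of x y u v]
        by (cases "p \<in> R - A") (auto simp: p w(1) V_def PiE_iff extensional_def)
    qed
    ultimately show ?thesis
      by (simp add: enc_def w(1))
  qed
  have enc_in: "enc f \<in> U \<times> V" if "f \<in> retractions X ?P" for f
  proof -
    have "f (x, x) \<in> D" if "x \<in> X" for x
      using that \<open>f \<in> _\<close> by (force simp: retractions_def swap_pair_def simp flip: diag)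
    moreover have "swap_pair f p \<in> ?P" if "p \<in> R" for p
      using that \<open>f \<in> _\<close> assms(3) by (auto simp: retractions_def)
    ultimately show ?thesis
      by (auto simp: enc_def U_def V_def)
  qed
  have dec_enc: "dec (enc f) = f" if f: "f \<in> retractions X ?P" for f
  proof
    fix p :: "'a \<times> 'a"
    obtain x y where p: "p = (x, y)"
      by fastforce
    show "dec (enc f) p = f p"
    proof (cases "x \<in> X \<and> y \<in> X")
      case True
      have "f (x, y) = x" if "(x, y) \<in> ?P"
        using f that by (force simp: retractions_def swap_pair_def)
      then show ?thesis
        using True Rcases[of x y] PR[of "(x, y)"] PR[of "(y, x)"] Psym[of x y] diag[of x]
        by (auto simp: p dec_def enc_def swap_pair_def)
    next
      case False
      \<comment> \<open>Outside the square both sides are \<open>undefined\<close> by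
        extensionality.\<close>
      then show ?thesis
        using f by (auto simp: p dec_def enc_def retractions_def PiE_iff extensional_def)
    qed
  qed
  have "bij_betw enc (retractions X ?P) (U \<times> V)"
    by (rule bij_betw_byWitness[where f' = dec]) (use dec_retr enc_dec enc_in dec_enc in blast)+
  then have "card (retractions X ?P) = card U * card V"
    by (simp add: bij_betw_same_card card_cartesian_product)
  also have "card U = card D ^ (card X - card D)"
    using assms(1,5) fin by (simp add: U_def card_PiE card_Diff_subset)
  also have "card V = (2 * card A + card D) ^ (card R - card A)"
    using assms(6) fin by (simp add: V_def card_PiE card_Diff_subset card_sym_points[OF assms(4,6)])
  finally show ?thesis .
qed

lemma idempotents_eq_UN_retractions:
  assumes "total_on X R" "R \<subseteq> X \<times> X" "asym R"
  shows "idempotents (binops X) =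
    (\<Union>(D, A) \<in> Pow X \<times> Pow R. retractions X (sym_points D A))"
proof (intro equalityI subsetI)
  fix f
  assume f: "f \<in> idempotents (binops X)"
  define P where "P = {p \<in> X \<times> X. swap_pair f p = p}"
  \<comment> \<open>\<open>P\<close> is swap-invariant because \<open>swap_pair f\<close> commutes
    with the swap, and totality of \<open>R\<close> puts each off-diagonal point or its swap in
    \<open>R\<close>.\<close>
  have "P = sym_points {x. (x, x) \<in> P} (P \<inter> R)"
    using assms by (auto simp: P_def sym_points_def swap_pair_def total_on_def)
  moreover have "{x. (x, x) \<in> P} \<subseteq> X"
    by (auto simp: P_def)
  moreover have "f \<in> retractions X P"
    using idempotents_retractions[OF f] by (simp add: P_def)
  ultimately show "f \<in> (\<Union>(D, A) \<in> Pow X \<times> Pow R. retractions X (sym_points D A))"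
    by (intro UN_I[of "({x. (x, x) \<in> P}, P \<inter> R)"]) auto
qed (auto intro: retractions_idempotents)

lemma sum_Pow_card:
  fixes g :: "nat \<Rightarrow> nat"
  assumes "finite S"
  shows "(\<Sum>T \<in> Pow S. g (card T)) = (\<Sum>k = 0..card S. (card S choose k) * g k)"
proof -
  have "(\<Sum>T \<in> Pow S. g (card T)) =
      (\<Sum>k = 0..card S. \<Sum>T \<in> {T \<in> Pow S. card T = k}. g (card T))"
    using assms by (intro sum.group[symmetric]) (auto intro: card_mono)
  also have "\<dots> = (\<Sum>k = 0..card S. (card S choose k) * g k)"
    using n_subsets[OF assms] by (intro sum.cong) auto
  finally show ?thesis .
qed

theorem theorem23:
  fixes X :: "'a set" and n N :: nat
  assumes "finite X" and "X \<noteq> {}"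
    and "n = card X" and "N = n choose 2"
  shows "card (idempotents (binops X)) =
    (\<Sum>d = 1..n. (n choose d) * d ^ (n - d) *
       (\<Sum>a = 0..N. (N choose a) * (2 * a + d) ^ (N - a)))"
proof -
  obtain R where R: "total_on X R" "R \<subseteq> X \<times> X" "asym R"
    using ex_total_asym[OF assms(1)] .
  have cR: "card R = N"
    using card_total_asym[OF assms(1) R] assms by simp
  have finR: "finite R"
    using R(2) assms(1) finite_subset by blast
  let ?h = "\<lambda>d. d ^ (n - d) * (\<Sum>a = 0..N. (N choose a) * (2 * a + d) ^ (N - a))"
  let ?S = "\<lambda>w. retractions X (sym_points (fst w) (snd w))"
  have fin: "finite (?S w)" for w
    using assms(1) by (simp add: retractions_def finite_PiE)
  \<comment> \<open>A common element would have both sets of points as its fixed-point set, so the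
    index pairs would coincide.\<close>
  have disj: "?S w \<inter> ?S w' = {}" if "w \<in> Pow X \<times> Pow R" "w' \<in> Pow X \<times> Pow R" "w \<noteq> w'" for w w'
  proof (rule ccontr)
    assume "?S w \<inter> ?S w' \<noteq> {}"
    then obtain f where "f \<in> ?S w" "f \<in> ?S w'"
      by blast
    moreover have "sym_points (fst v) (snd v) \<subseteq> X \<times> X" if "v \<in> Pow X \<times> Pow R" for v
      using that R(2) by (intro sym_points_subset) auto
    ultimately have "sym_points (fst w) (snd w) = sym_points (fst w') (snd w')"
      using retractions_fixed_points[of f X "sym_points (fst w) (snd w)"]
        retractions_fixed_points[of f X "sym_points (fst w') (snd w')"] that by simp
    with sym_points_inject[OF R(3), of "snd w" "snd w'" "fst w" "fst w'"] that show False
      by (simp add: prod_eq_iff mem_Times_iff)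
  qed
  have "card (idempotents (binops X)) = (\<Sum>w \<in> Pow X \<times> Pow R. card (?S w))"
    unfolding idempotents_eq_UN_retractions[OF R] case_prod_beta
    using assms(1) finR disj fin by (intro card_UN_disjoint) auto
  also have "\<dots> = (\<Sum>D \<in> Pow X. \<Sum>A \<in> Pow R. card (retractions X (sym_points D A)))"
    by (simp add: sum.cartesian_product case_prod_beta)
  also have "\<dots> = (\<Sum>D \<in> Pow X. \<Sum>A \<in> Pow R.
      card D ^ (n - card D) * (2 * card A + card D) ^ (N - card A))"
    using card_retractions[OF assms(1) R] cR assms(3) by (intro sum.cong) auto
  \<comment> \<open>With \<open>D\<close> held fixed, the summand depends on \<open>A\<close> only
    through its size, so the subsets of \<open>R\<close> are grouped by cardinality.\<close>
  also have "\<dots> = (\<Sum>D \<in> Pow X. ?h (card D))"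
    using sum_Pow_card[OF finR, of "\<lambda>a. (2 * a + d) ^ (N - a)" for d]
    by (simp add: cR flip: sum_distrib_left)
  also have "\<dots> = (\<Sum>d = 0..n. (n choose d) * ?h d)"
    using sum_Pow_card[OF assms(1), of ?h] assms(3) by simp
  also have "\<dots> = (\<Sum>d = 1..n. (n choose d) * ?h d)"
    \<comment> \<open>the term \<open>d = 0\<close> vanishes because \<open>0 ^ n = 0\<close> for \<open>n > 0\<close>\<close>
    using assms(1-3) by (simp add: sum.atLeast_Suc_atMost card_gt_0_iff)
  finally show ?thesis
    by (simp add: mult.assoc)
qed

end
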